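(* Let $\mathcal{V}=\alpha+j\beta\in\mathbb{BC}$ ($\alpha,\beta\in\mathbb{C}(i)$) and $c>0$, with $\Re(\alpha)>|\Im(\beta)|$. Then the solution of the bicomplex generalization of the fractional kinetic equation $$N(t)-N_0=-c^{\mathcal{V}}D_t^{-\mathcal{V}}N(t),$$ where $N_0$ is a constant, is given by $$N(t)=N_0\sum_{r=0}^{\infty}\frac{(-1)^r(ct)^{\mathcal{V}r}}{\Gamma(\mathcal{V}r+1)}.$$
   Context: Bicomplex numbers: $\mathbb{BC}=\{w_1+jw_2: w_1,w_2\in\mathbb{C}(i)\}$, where $\mathbb{C}(i)$ is the complex field with unit $i$, $i^2=j^2=-1$, $ij=ji$. Put $e_1=\frac{1+ij}{2}$, $e_2=\frac{1-ij}{2}$, so $e_1+e_2=1$, $e_l^2=e_l$, $e_1e_2=0$. Every $Z=w_1+jw_2$ is uniquely $Z=z_1e_1+z_2e_2$ with $z_1=w_1-iw_2$, $z_2=w_1+iw_2\in\mathbb{C}(i)$, and addition, multiplication and division are componentwise in $e_1,e_2$; in particular $\mathcal{V}=\nu_1e_1+\nu_2e_2$ with $\nu_1=\alpha-i\beta$, $\nu_2=\alpha+i\beta$. Functions act componentwise: $\Gamma(Y)=\Gamma(y_1)e_1+\Gamma(y_2)e_2$, and for $x>0$ and $W=w_1e_1+w_2e_2$, $x^W=x^{w_1}e_1+x^{w_2}e_2$. Here $t>0$, and $N$ is the unknown bicomplex-valued function, locally integrable on $[0,\infty)$. $D_t^{-\mathcal{V}}$ is the Riemann-Liouville fractional integral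 of bicomplex order: for $f=f_1e_1+f_2e_2$, $D_t^{-\mathcal{V}}f=(D_t^{-\nu_1}f_1)e_1+(D_t^{-\nu_2}f_2)e_2$, with $D_t^{-\nu}g(t)=\frac{1}{\Gamma(\nu)}\int_0^t(t-\tau)^{\nu-1}g(\tau)\,d\tau$ for $\Re\nu>0$ (note $\Re(\alpha)>|\Im(\beta)|$ says $\Re\nu_1,\Re\nu_2>0$). *)

theory Defs
  imports "HOL-Analysis.Analysis"
begin

section \<open>The ring of bicomplex numbers\<close>

text \<open>\<open>Bicomplex w\<^sub>1 w\<^sub>2\<close> is \<open>w\<^sub>1 + j w\<^sub>2\<close>; the type \<^typ>\<open>complex\<close> is the field with unit \<open>i\<close>.\<close>

datatype bicomplex = Bicomplex (bc_w1: complex) (bc_w2: complex)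

lemma bicomplex_eq_iff: "Z = W \<longleftrightarrow> bc_w1 Z = bc_w1 W \<and> bc_w2 Z = bc_w2 W"
  by (cases Z; cases W) simp

instantiation bicomplex :: comm_ring_1
begin

definition "0 = Bicomplex 0 0"
definition "1 = Bicomplex 1 0"
definition "Z + W = Bicomplex (bc_w1 Z + bc_w1 W) (bc_w2 Z + bc_w2 W)"
definition "Z - W = Bicomplex (bc_w1 Z - bc_w1 W) (bc_w2 Z - bc_w2 W)"
definition "- Z = Bicomplex (- bc_w1 Z) (- bc_w2 Z)"
definition "Z * W = Bicomplex (bc_w1 Z * bc_w1 W - bc_w2 Z * bc_w2 W)
                              (bc_w1 Z * bc_w2 W + bc_w2 Z * bc_w1 W)"

lemmas bicomplex_ring_defs = zero_bicomplex_def one_bicomplex_def plus_bicomplex_def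
  minus_bicomplex_def uminus_bicomplex_def times_bicomplex_def

instance
  by standard (auto simp: bicomplex_ring_defs bicomplex_eq_iff algebra_simps)

end

text \<open>The topology, hence the meaning of bicomplex series, comes from the Euclidean norm
  on \<open>\<complex>\<^sup>2\<close>.\<close>

instantiation bicomplex :: real_normed_vector
begin

definition "a *\<^sub>R Z = Bicomplex (a *\<^sub>R bc_w1 Z) (a *\<^sub>R bc_w2 Z)"
definition "norm Z = sqrt ((norm (bc_w1 Z))\<^sup>2 + (norm (bc_w2 Z))\<^sup>2)"
definition "sgn (Z :: bicomplex) = inverse (norm Z) *\<^sub>R Z"
definition "dist Z (W :: bicomplex) = norm (Z - W)"
definition [code del]: "(uniformity :: (bicomplex \<times> bicomplex) filter) =
  (INF e\<in>{0 <..}. principal {(Z, W). dist Z W < e})"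
definition [code del]: "open (U :: bicomplex set) \<longleftrightarrow>
  (\<forall>Z\<in>U. eventually (\<lambda>(Z', W). Z' = Z \<longrightarrow> W \<in> U) uniformity)"

lemma norm_bicomplex_eq_prod: "norm Z = norm (bc_w1 Z, bc_w2 Z)"
  by (simp add: norm_bicomplex_def norm_Pair)

instance
proof
  fix Z W :: bicomplex and a b :: real
  show "a *\<^sub>R (Z + W) = a *\<^sub>R Z + a *\<^sub>R W" "(a + b) *\<^sub>R Z = a *\<^sub>R Z + b *\<^sub>R Z"
    "a *\<^sub>R b *\<^sub>R Z = (a * b) *\<^sub>R Z" "1 *\<^sub>R Z = Z"
    by (simp_all add: scaleR_bicomplex_def plus_bicomplex_def bicomplex_eq_iff algebra_simps)
  show "norm Z = 0 \<longleftrightarrow> Z = 0"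
    by (simp add: norm_bicomplex_def zero_bicomplex_def bicomplex_eq_iff add_nonneg_eq_0_iff)
  show "norm (Z + W) \<le> norm Z + norm W"
    using norm_triangle_ineq[of "(bc_w1 Z, bc_w2 Z)" "(bc_w1 W, bc_w2 W)"]
    by (simp add: norm_bicomplex_eq_prod plus_bicomplex_def)
  show "norm (a *\<^sub>R Z) = \<bar>a\<bar> * norm Z"
    using norm_scaleR[of a "(bc_w1 Z, bc_w2 Z)"]
    by (simp add: norm_bicomplex_eq_prod scaleR_bicomplex_def)
qed (simp_all add: sgn_bicomplex_def dist_bicomplex_def uniformity_bicomplex_def
      open_bicomplex_def)

end

section \<open>Idempotent representation\<close>

definition bc_of_complex :: "complex \<Rightarrow> bicomplex"
  where "bc_of_complex w = Bicomplex w 0"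

definition bc_j :: bicomplex
  where "bc_j = Bicomplex 0 1"

lemma Bicomplex_eq: "Bicomplex w1 w2 = bc_of_complex w1 + bc_j * bc_of_complex w2"
  by (simp add: bc_of_complex_def bc_j_def bicomplex_ring_defs)

lemma bc_j_squared: "bc_j * bc_j = - 1"
  by (simp add: bc_j_def bicomplex_ring_defs)

definition bc_e1 :: bicomplex
  where "bc_e1 = bc_of_complex (1/2) * (1 + bc_of_complex \<i> * bc_j)"

definition bc_e2 :: bicomplex
  where "bc_e2 = bc_of_complex (1/2) * (1 - bc_of_complex \<i> * bc_j)"

definition bc_z1 :: "bicomplex \<Rightarrow> complex"
  where "bc_z1 Z = bc_w1 Z - \<i> * bc_w2 Z"

definition bc_z2 :: "bicomplex \<Rightarrow> complex"
  where "bc_z2 Z = bc_w1 Z + \<i> * bc_w2 Z"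

definition bc_idem :: "complex \<Rightarrow> complex \<Rightarrow> bicomplex"
  where "bc_idem z1 z2 = bc_of_complex z1 * bc_e1 + bc_of_complex z2 * bc_e2"

lemma bc_e_simps:
  "bc_e1 + bc_e2 = 1" "bc_e1 * bc_e1 = bc_e1" "bc_e2 * bc_e2 = bc_e2" "bc_e1 * bc_e2 = 0"
  by (simp_all add: bc_e1_def bc_e2_def bc_of_complex_def bc_j_def bicomplex_ring_defs
      complex_eq_iff)

lemma bc_idem_z [simp]: "bc_idem (bc_z1 Z) (bc_z2 Z) = Z"
  by (simp add: bc_idem_def bc_e1_def bc_e2_def bc_of_complex_def bc_j_def bicomplex_ring_defs
      bc_z1_def bc_z2_def bicomplex_eq_iff complex_eq_iff field_simps)

lemma bc_z_idem [simp]: "bc_z1 (bc_idem z1 z2) = z1" "bc_z2 (bc_idem z1 z2) = z2"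
  by (simp_all add: bc_idem_def bc_e1_def bc_e2_def bc_of_complex_def bc_j_def
      bicomplex_ring_defs bc_z1_def bc_z2_def complex_eq_iff field_simps)

lemma bicomplex_eq_iff_z: "Z = W \<longleftrightarrow> bc_z1 Z = bc_z1 W \<and> bc_z2 Z = bc_z2 W"
  by (metis bc_idem_z)

lemma bc_z_ring [simp]:
  "bc_z1 0 = 0" "bc_z2 0 = 0" "bc_z1 1 = 1" "bc_z2 1 = 1"
  "bc_z1 (Z + W) = bc_z1 Z + bc_z1 W" "bc_z2 (Z + W) = bc_z2 Z + bc_z2 W"
  "bc_z1 (Z - W) = bc_z1 Z - bc_z1 W" "bc_z2 (Z - W) = bc_z2 Z - bc_z2 W"
  "bc_z1 (- Z) = - bc_z1 Z" "bc_z2 (- Z) = - bc_z2 Z"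
  "bc_z1 (Z * W) = bc_z1 Z * bc_z1 W" "bc_z2 (Z * W) = bc_z2 Z * bc_z2 W"
  by (simp_all add: bc_z1_def bc_z2_def bicomplex_ring_defs algebra_simps)

text \<open>Division is the componentwise one. It is the genuine quotient when both idempotent
  components of the divisor are nonzero, i.e. when the divisor is a unit; otherwise the
  convention \<open>x / 0 = 0\<close> applies in each component.\<close>

instantiation bicomplex :: inverse
begin

definition "Z div W = bc_idem (bc_z1 Z / bc_z1 W) (bc_z2 Z / bc_z2 W)"
definition "inverse W = bc_idem (inverse (bc_z1 W)) (inverse (bc_z2 W))"

instance ..

end

lemma bicomplex_divide_mult_cancel:
  assumes "bc_z1 W \<noteq> 0" "bc_z2 W \<noteq> 0"
  shows "(Z / W) * W = Z"
  using assms by (simp add: divide_bicomplex_def bicomplex_eq_iff_z)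

definition bc_Gamma :: "bicomplex \<Rightarrow> bicomplex"
  where "bc_Gamma Y = bc_idem (Gamma (bc_z1 Y)) (Gamma (bc_z2 Y))"

definition bc_powr :: "real \<Rightarrow> bicomplex \<Rightarrow> bicomplex"  (infixr "bc'_powr" 80)
  where "x bc_powr W = bc_idem (of_real x powr bc_z1 W) (of_real x powr bc_z2 W)"

section \<open>Fractional integrals of bicomplex order\<close>

definition RL_integrand :: "complex \<Rightarrow> (real \<Rightarrow> complex) \<Rightarrow> real \<Rightarrow> real \<Rightarrow> complex"
  where "RL_integrand \<nu> g t \<tau> = of_real (t - \<tau>) powr (\<nu> - 1) * g \<tau>"

definition RL_integral :: "complex \<Rightarrow> (real \<Rightarrow> complex) \<Rightarrow> real \<Rightarrow> complex"
  where "RL_integral \<nu> g t = 1 / Gamma \<nu> * (LINT \<tau>:{0..t}|lebesgue. RL_integrand \<nu> g t \<tau>)"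

definition bc_RL_integral :: "bicomplex \<Rightarrow> (real \<Rightarrow> bicomplex) \<Rightarrow> real \<Rightarrow> bicomplex"
  where "bc_RL_integral V f t =
    bc_idem (RL_integral (bc_z1 V) (\<lambda>\<tau>. bc_z1 (f \<tau>)) t)
            (RL_integral (bc_z2 V) (\<lambda>\<tau>. bc_z2 (f \<tau>)) t)"

text \<open>The Lebesgue integral is totalised to \<open>0\<close>, so the convergence of the integrals that
  define the fractional integral at \<open>t\<close> is a separate predicate.\<close>

definition bc_RL_exists :: "bicomplex \<Rightarrow> (real \<Rightarrow> bicomplex) \<Rightarrow> real \<Rightarrow> bool"
  where "bc_RL_exists V f t \<longleftrightarrow>
    RL_integrand (bc_z1 V) (\<lambda>\<tau>. bc_z1 (f \<tau>)) t absolutely_integrable_on {0..t} \<and>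
    RL_integrand (bc_z2 V) (\<lambda>\<tau>. bc_z2 (f \<tau>)) t absolutely_integrable_on {0..t}"

definition bc_locally_integrable :: "(real \<Rightarrow> bicomplex) \<Rightarrow> bool"
  where "bc_locally_integrable f \<longleftrightarrow>
    (\<forall>T>0. (\<lambda>\<tau>. bc_z1 (f \<tau>)) absolutely_integrable_on {0..T} \<and>
           (\<lambda>\<tau>. bc_z2 (f \<tau>)) absolutely_integrable_on {0..T})"

definition solves_fractional_kinetic ::
    "bicomplex \<Rightarrow> real \<Rightarrow> bicomplex \<Rightarrow> (real \<Rightarrow> bicomplex) \<Rightarrow> bool"
  where "solves_fractional_kinetic V c N0 N \<longleftrightarrow>
    bc_locally_integrable N \<and>
    (\<forall>t>0. bc_RL_exists V N t \<and>
           N t - N0 = - ((c bc_powr V) * bc_RL_integral V N t))"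

end

theory Submission
  imports Defs
begin

text \<open>In the idempotent components the equation splits into two scalar Volterra equations with
  kernel \<open>(t - \<tau>) powr (\<nu> - 1)\<close>, \<open>Re \<nu> > 0\<close>. Euler's Beta integral with complex parameters
  says that the fractional integral maps \<open>t powr (\<nu> r) / Gamma (\<nu> r + 1)\<close> to
  \<open>t powr (\<nu> (r + 1)) / Gamma (\<nu> (r + 1) + 1)\<close>, so integrating the series termwise shifts it by one
  index; since \<open>Beta \<nu> (\<nu> r + 1)\<close> tends to \<open>0\<close>, the ratio test gives absolute convergence. For
  uniqueness, the difference of two locally integrable solutions solves the homogeneous equation,
  and in \<open>L\<^sup>1([0,T])\<close> with weight \<open>exp (- \<kappa> t)\<close> the integral operator is a contraction for
  large \<open>\<kappa>\<close>; the difference vanishes almost everywhere, and then everywhere by the equation.\<close>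

section \<open>Power kernels and the Beta integral\<close>

text \<open>Cutting the power off on the nonpositive axis turns a fractional integral over [0, t]
  into a convolution over the whole line, with the limits of integration built into the
  factors.\<close>

definition power_kernel :: "complex \<Rightarrow> real \<Rightarrow> complex"
  where "power_kernel a x = (if x > 0 then of_real x powr (a - 1) else 0)"

lemma borel_measurable_power_kernel [measurable]: "power_kernel a \<in> borel_measurable borel"
proof -
  \<comment> \<open>For positive x the complex power is an exponential of the real logarithm, which
    makes measurability visible.\<close>
  have "(\<lambda>x. if x > 0 then exp ((a - 1) * of_real (ln x)) else 0 :: complex) \<in> borel_measurable borel"
    by measurable
  also have "(\<lambda>x. if x > 0 then exp ((a - 1) * of_real (ln x)) else 0 :: complex) = power_kernel a"
    by (auto simp: power_kernel_def powr_def Ln_of_real fun_eq_iff)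
  finally show ?thesis .
qed

lemma norm_power_kernel: "norm (power_kernel a x) = (if x > 0 then x powr (Re a - 1) else 0)"
  by (simp add: power_kernel_def norm_powr_real_powr)

lemma power_kernel_mult:
  assumes "s > 0"
  shows "power_kernel a (s * x) = of_real s powr (a - 1) * power_kernel a x"
  using assms by (auto simp: power_kernel_def powr_times_real zero_less_mult_iff)

lemma notin_nonpos_Ints_if_Re_pos:
  assumes "Re z > 0"
  shows "z \<notin> \<int>\<^sub>\<le>\<^sub>0"
proof
  assume "z \<in> \<int>\<^sub>\<le>\<^sub>0"
  then obtain n where "z = of_int n" "n \<le> 0" by (elim nonpos_Ints_cases)
  with assms show False by simp
qed

lemma Re_mult_of_nat_add_1_pos:
  assumes "Re z > 0"
  shows "Re (z * of_nat r + 1) > 0"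
  using assms by (simp add: add_nonneg_pos)

text \<open>Euler's integral for Gamma, transferred to \<open>lborel\<close>, where Fubini is
  applied later. The integrand is Borel, so leaving the completion changes nothing.\<close>

lemma Gamma_power_kernel:
  assumes "Re a > 0"
  shows "integrable lborel (\<lambda>x. power_kernel a x * of_real (exp (- x)))"
    and "(LINT x|lborel. power_kernel a x * of_real (exp (- x))) = Gamma a"
proof -
  let ?f = "\<lambda>t. complex_of_real t powr (a - 1) / of_real (exp t)"
  have eq: "indicator {0<..} x *\<^sub>R ?f x = power_kernel a x * of_real (exp (- x))" for x
    by (simp add: power_kernel_def indicator_def exp_minus field_simps)
  have "?f absolutely_integrable_on {0<..}"
    by (rule absolutely_integrable_Gamma_integral'[OF assms])
  then have int: "integrable lebesgue (\<lambda>x. power_kernel a x * of_real (exp (- x)))"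
    and val: "(LINT x|lebesgue. power_kernel a x * of_real (exp (- x))) = Gamma a"
    using set_lebesgue_integral_eq_integral(2)[of "{0<..}" ?f]
      integral_unique[OF Gamma_integral_complex'[OF assms]]
    by (simp_all add: set_integrable_def set_lebesgue_integral_def eq)
  show "integrable lborel (\<lambda>x. power_kernel a x * of_real (exp (- x)))"
    using int by (subst (asm) integrable_completion) auto
  show "(LINT x|lborel. power_kernel a x * of_real (exp (- x))) = Gamma a"
    using val by (subst (asm) integral_completion) auto
qed

lemma integrable_lborel_reflect:
  fixes f :: "real \<Rightarrow> 'a::{banach, second_countable_topology}"
  assumes "integrable lborel f"
  shows "integrable lborel (\<lambda>x. f (t - x))"
  using lborel_integrable_real_affine[OF assms, of "-1" t] by simp

lemma integrable_lborel_translate: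
  fixes f :: "real \<Rightarrow> 'a::{banach, second_countable_topology}"
  assumes "integrable lborel f"
  shows "integrable lborel (\<lambda>x. f (x - t))"
  using lborel_integrable_real_affine[OF assms, of 1 "-t"] by simp

lemma lborel_integral_translate:
  fixes f :: "real \<Rightarrow> 'a::{banach, second_countable_topology}"
  shows "(LINT x|lborel. f (x - t)) = (LINT x|lborel. f x)"
  using lborel_integral_real_affine[of 1 f "-t"] by simp

text \<open>Fubini: by translation invariance the norm of the integrand integrates over x to a
  constant times \<open>norm (g u)\<close>, which gives joint integrability.\<close>

lemma integral_convolution:
  fixes f g :: "real \<Rightarrow> complex"
  assumes f: "integrable lborel f" and g: "integrable lborel g"
  shows "(LINT x|lborel. LINT u|lborel. f (x - u) * g u) = integral\<^sup>L lborel f * integral\<^sup>L lborel g"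
proof -
  have [measurable]: "f \<in> borel_measurable borel" "g \<in> borel_measurable borel"
    using f g by auto
  have "integrable (lborel \<Otimes>\<^sub>M lborel) (\<lambda>(u, x). f (x - u) * g u)"
  proof (rule lborel_pair.Fubini_integrable)
    show "AE u in lborel. integrable lborel (\<lambda>x. case (u, x) of (u, x) \<Rightarrow> f (x - u) * g u)"
      using integrable_lborel_translate[OF f] by auto
    have "(LINT x|lborel. norm (f (x - u) * g u)) = (LINT x|lborel. norm (f x)) * norm (g u)" for u
      using lborel_integral_translate[of "\<lambda>x. norm (f x)" u] by (simp add: norm_mult)
    then show "integrable lborel (\<lambda>u. LINT x|lborel. norm (case (u, x) of (u, x) \<Rightarrow> f (x - u) * g u))"
      using g by simp
  qed measurable
  from lborel_pair.Fubini_integral[OF this]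
  show ?thesis
    by (simp add: lborel_integral_translate)
qed

section \<open>Euler's Beta integral as a convolution of kernels\<close>

lemma integrable_power_kernel_atMost:
  assumes "Re a > 0"
  shows "integrable lborel (\<lambda>x. indicator {..t} x *\<^sub>R power_kernel a x)"
proof -
  have "integrable lborel (\<lambda>x. of_real (exp t) * (power_kernel a x * of_real (exp (- x))))"
    using Gamma_power_kernel(1)[OF assms] by simp
  then show ?thesis
  proof (rule Bochner_Integration.integrable_bound)
    \<comment> \<open>For x <= t the factor \<open>exp (t - x)\<close> is at least 1, so
      \<open>exp t\<close> times the Gamma integrand is a majorant.\<close>
    have "norm (power_kernel a x) \<le> norm (complex_of_real (exp t) * (power_kernel a x * of_real (exp (- x))))"
      if "x \<le> t" for x
    proof -
      have "norm (complex_of_real (exp t) * (power_kernel a x * of_real (exp (- x))))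
          = exp (t - x) * norm (power_kernel a x)"
        by (simp only: norm_mult norm_of_real abs_exp_cancel) (simp add: exp_diff exp_minus divide_inverse)
      with that show ?thesis
        using mult_right_mono[of 1 "exp (t - x)" "norm (power_kernel a x)"] by simp
    qed
    then show "AE x in lborel. norm (indicator {..t} x *\<^sub>R power_kernel a x)
        \<le> norm (complex_of_real (exp t) * (power_kernel a x * of_real (exp (- x))))"
      by (intro AE_I2) (auto simp: indicator_def)
  qed measurable
qed

text \<open>By scaling, the convolution is a constant \<open>B\<close> times the kernel of index a +
  b. Integrating against \<open>exp (- x)\<close> identifies \<open>B\<close>: the convolution of
  the two Gamma integrands has total integral Gamma a * Gamma b, and it also equals Gamma (a + b) *
  B.\<close>

lemma Beta_convolution:
  assumes a: "Re a > 0" and b: "Re b > 0" and s: "s > 0"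
  shows "(LINT u|lborel. power_kernel a (s - u) * power_kernel b u) = of_real s powr (a + b - 1) * Beta a b"
proof -
  define B where "B = (LINT u|lborel. power_kernel a (1 - u) * power_kernel b u)"
  have scale: "(LINT u|lborel. power_kernel a (x - u) * power_kernel b u) = power_kernel (a + b) x * B"
    for x
  proof (cases "x > 0")
    case True
    have k: "power_kernel a (x - x * u) = of_real x powr (a - 1) * power_kernel a (1 - u)" for u
      using power_kernel_mult[OF True, of a "1 - u"] by (simp add: algebra_simps)
    \<comment> \<open>After replacing u by x * u, the Jacobian and the two kernels contribute x to
      the powers 1, a - 1 and b - 1.\<close>
    have "(LINT u|lborel. power_kernel a (x - u) * power_kernel b u)
        = x *\<^sub>R (LINT u|lborel. power_kernel a (x - x * u) * power_kernel b (x * u))"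
      using True lborel_integral_real_affine[of x "\<lambda>u. power_kernel a (x - u) * power_kernel b u" 0]
      by simp
    also have "\<dots> = x *\<^sub>R (LINT u|lborel. (of_real x powr (a - 1) * of_real x powr (b - 1)) *
        (power_kernel a (1 - u) * power_kernel b u))"
      unfolding k power_kernel_mult[OF True] by (simp only: mult_ac)
    also have "\<dots> = (of_real x * (of_real x powr (a - 1) * of_real x powr (b - 1))) * B"
      by (subst integral_mult_right_zero) (simp add: B_def scaleR_conv_of_real)
    also have "of_real x * (of_real x powr (a - 1) * of_real x powr (b - 1)) = power_kernel (a + b) x"
      using True by (simp add: power_kernel_def powr_diff powr_add field_simps)
    finally show ?thesis .
  next
    case False
    \<comment> \<open>For x <= 0 no u satisfies both u > 0 and x - u > 0.\<close>
    then have "power_kernel a (x - u) * power_kernel b u = 0" for u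
      by (simp add: power_kernel_def)
    with False show ?thesis
      by (simp only: power_kernel_def[of "a + b"]) simp
  qed
  have ab: "Re (a + b) > 0" using a b by simp
  let ?h = "\<lambda>a x. power_kernel a x * of_real (exp (- x))"
  have "Gamma a * Gamma b = (LINT x|lborel. LINT u|lborel. ?h a (x - u) * ?h b u)"
    using integral_convolution[OF Gamma_power_kernel(1)[OF a] Gamma_power_kernel(1)[OF b]]
    by (simp add: Gamma_power_kernel(2) a b)
  also have "\<dots> = (LINT x|lborel. of_real (exp (- x)) *
      (LINT u|lborel. power_kernel a (x - u) * power_kernel b u))"
  proof (intro Bochner_Integration.integral_cong refl)
    fix x :: real
    \<comment> \<open>The two exponential weights combine to \<open>exp (- x)\<close>, which is
      independent of u.\<close>
    have "?h a (x - u) * ?h b u = of_real (exp (- x)) * (power_kernel a (x - u) * power_kernel b u)" for u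
    proof -
      have "complex_of_real (exp (- (x - u))) * of_real (exp (- u)) = of_real (exp (- x))"
        by (simp flip: of_real_mult exp_add)
      then show ?thesis by (metis mult.assoc mult.left_commute mult.commute)
    qed
    then show "(LINT u|lborel. ?h a (x - u) * ?h b u) = of_real (exp (- x)) *
      (LINT u|lborel. power_kernel a (x - u) * power_kernel b u)"
      by (simp only: integral_mult_right_zero)
  qed
  also have "\<dots> = (LINT x|lborel. ?h (a + b) x) * B"
    unfolding scale by (simp add: mult_ac flip: integral_mult_left_zero)
  also have "\<dots> = Gamma (a + b) * B" by (simp only: Gamma_power_kernel(2)[OF ab])
  finally have "B = Beta a b"
    using notin_nonpos_Ints_if_Re_pos[OF ab] by (simp add: Beta_def Gamma_eq_zero_iff field_simps)
  with scale[of s] s show ?thesis by (simp add: power_kernel_def)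
qed

text \<open>This weight of the fractional integral on (0, t) serves as the integrable majorant in
  the limit theorems.\<close>

lemma integrable_power_kernel_reflect:
  assumes a: "Re a > 0"
  shows "integrable lborel (\<lambda>u. indicator {0<..} u *\<^sub>R power_kernel a (t - u))"
proof -
  have "integrable lborel (\<lambda>u. indicator {..t} (t - u) *\<^sub>R power_kernel a (t - u))"
    by (rule integrable_lborel_reflect[OF integrable_power_kernel_atMost[OF a]])
  then show ?thesis
    by (rule Bochner_Integration.integrable_bound) (auto simp: indicator_def)
qed

section \<open>Absolute convergence of the Mittag-Leffler series\<close>

lemma Beta_tendsto_0:
  assumes \<nu>: "Re \<nu> > 0"
  shows "(\<lambda>r. Beta \<nu> (\<nu> * of_nat r + 1)) \<longlonglongrightarrow> 0"
proof -
  \<comment> \<open>Dominated convergence: on (0, 1) the second kernel has norm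
    \<open>(u powr Re \<nu>) ^ r\<close>, which is at most 1 and tends to 0; elsewhere the product
    vanishes.\<close>
  have "(\<lambda>r. LINT u|lborel. power_kernel \<nu> (1 - u) * power_kernel (\<nu> * of_nat r + 1) u)
      \<longlonglongrightarrow> (LINT (u::real)|lborel. 0 :: complex)"
  proof (rule integral_dominated_convergence[where
        w = "\<lambda>u. norm (indicator {0<..} u *\<^sub>R power_kernel \<nu> (1 - u))"])
    show "integrable lborel (\<lambda>u. norm (indicator {0<..} u *\<^sub>R power_kernel \<nu> (1 - u)))"
      by (intro integrable_norm integrable_power_kernel_reflect \<nu>)
    show "AE u in lborel. (\<lambda>r. power_kernel \<nu> (1 - u) * power_kernel (\<nu> * of_nat r + 1) u) \<longlonglongrightarrow> 0"
    proof (rule AE_I2)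
      fix u :: real
      show "(\<lambda>r. power_kernel \<nu> (1 - u) * power_kernel (\<nu> * of_nat r + 1) u) \<longlonglongrightarrow> 0"
      proof (cases "0 < u \<and> u < 1")
        case True
        then have "(\<lambda>r. (u powr Re \<nu>) ^ r) \<longlonglongrightarrow> 0"
          using \<nu> powr_less_mono2[of "Re \<nu>" u 1] by (intro LIMSEQ_power_zero) auto
        moreover have "norm (power_kernel (\<nu> * of_nat r + 1) u) = (u powr Re \<nu>) ^ r" for r
          using True by (simp add: norm_power_kernel powr_power mult.commute)
        ultimately have "(\<lambda>r. norm (power_kernel (\<nu> * of_nat r + 1) u)) \<longlonglongrightarrow> 0"
          by simp
        then show ?thesis
          by (intro tendsto_mult_right_zero) (simp only: tendsto_norm_zero_iff)
      qed (auto simp: power_kernel_def)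
    qed
    show "AE u in lborel. norm (power_kernel \<nu> (1 - u) * power_kernel (\<nu> * of_nat r + 1) u)
        \<le> norm (indicator {0<..} u *\<^sub>R power_kernel \<nu> (1 - u))" for r
    proof (rule AE_I2)
      fix u :: real
      show "norm (power_kernel \<nu> (1 - u) * power_kernel (\<nu> * of_nat r + 1) u)
        \<le> norm (indicator {0<..} u *\<^sub>R power_kernel \<nu> (1 - u))"
      proof (cases "0 < u \<and> u < 1")
        case True
        then have "norm (power_kernel (\<nu> * of_nat r + 1) u) \<le> 1"
          using \<nu> by (simp add: norm_power_kernel powr_le1)
        then show ?thesis
          using True by (simp add: norm_mult mult_left_le)
      qed (auto simp: power_kernel_def)
    qed
  qed measurable
  then show ?thesis
    by (simp add: Beta_convolution[OF \<nu> Re_mult_of_nat_add_1_pos[OF \<nu>]])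
qed

text \<open>Ratio test: the factor from one term to the next has norm \<open>\<bar>x\<bar> * norm
  (Beta \<nu> (\<nu> * of_nat r + 1)) / norm (Gamma \<nu>)\<close>, which tends to 0.\<close>

lemma summable_Mittag_Leffler:
  assumes \<nu>: "Re \<nu> > 0"
  shows "summable (\<lambda>r. x ^ r * norm (rGamma (\<nu> * of_nat r + 1)))"
proof -
  \<comment> \<open>The Gamma quotient for Beta, read as a recursion for reciprocal Gamma
    values.\<close>
  have G: "rGamma (\<nu> * of_nat (Suc r) + 1) * Gamma \<nu> = Beta \<nu> (\<nu> * of_nat r + 1) * rGamma (\<nu> * of_nat r + 1)" for r
  proof -
    have "Gamma (\<nu> * of_nat r + 1) * rGamma (\<nu> * of_nat r + 1) = 1"
      using notin_nonpos_Ints_if_Re_pos[OF Re_mult_of_nat_add_1_pos[OF \<nu>]]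
      by (simp add: rGamma_inverse_Gamma Gamma_eq_zero_iff)
    then show ?thesis
      by (simp add: Beta_altdef algebra_simps)
  qed
  have "Gamma \<nu> \<noteq> 0"
    using notin_nonpos_Ints_if_Re_pos[OF \<nu>] by (simp add: Gamma_eq_zero_iff)
  have "(\<lambda>r. \<bar>x\<bar> * norm (Beta \<nu> (\<nu> * of_nat r + 1)) / norm (Gamma \<nu>)) \<longlonglongrightarrow> \<bar>x\<bar> * 0 / norm (Gamma \<nu>)"
    by (intro tendsto_intros tendsto_norm_zero Beta_tendsto_0 \<nu>) (use \<open>Gamma \<nu> \<noteq> 0\<close> in auto)
  then have "\<forall>\<^sub>F r in sequentially. \<bar>x\<bar> * norm (Beta \<nu> (\<nu> * of_nat r + 1)) / norm (Gamma \<nu>) < 1/2"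
    by (rule order_tendstoD) simp
  then obtain n where n: "\<And>r. r \<ge> n \<Longrightarrow> \<bar>x\<bar> * norm (Beta \<nu> (\<nu> * of_nat r + 1)) / norm (Gamma \<nu>) < 1/2"
    by (auto simp: eventually_sequentially)
  show ?thesis
  proof (rule summable_ratio_test)
    fix r assume "n \<le> r"
    have "norm (rGamma (\<nu> * of_nat (Suc r) + 1)) =
        norm (Beta \<nu> (\<nu> * of_nat r + 1)) / norm (Gamma \<nu>) * norm (rGamma (\<nu> * of_nat r + 1))"
      using arg_cong[OF G[of r], of norm] \<open>Gamma \<nu> \<noteq> 0\<close> by (simp add: norm_mult field_simps)
    then have "norm (x ^ Suc r * norm (rGamma (\<nu> * of_nat (Suc r) + 1)))
        = (\<bar>x\<bar> * norm (Beta \<nu> (\<nu> * of_nat r + 1)) / norm (Gamma \<nu>)) *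
          (\<bar>x\<bar> ^ r * norm (rGamma (\<nu> * of_nat r + 1)))"
      by (simp add: abs_mult power_abs)
    also have "\<dots> \<le> 1/2 * (\<bar>x\<bar> ^ r * norm (rGamma (\<nu> * of_nat r + 1)))"
      using n[OF \<open>n \<le> r\<close>] by (intro mult_right_mono) auto
    finally show "norm (x ^ Suc r * norm (rGamma (\<nu> * of_nat (Suc r) + 1)))
        \<le> 1/2 * norm (x ^ r * norm (rGamma (\<nu> * of_nat r + 1)))"
      by (simp add: abs_mult power_abs)
  qed simp
qed

section \<open>The homogeneous Volterra equation\<close>

text \<open>Rescaling x to x / \<kappa> gives 1 / \<kappa> from the measure and
  \<open>\<kappa> powr (1 - Re a)\<close> from the kernel. For Re a > 0 the weighted mass of the
  kernel thus becomes arbitrarily small as \<kappa> grows.\<close>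

lemma nn_integral_exp_power_kernel:
  assumes "\<kappa> > 0"
  shows "(\<integral>\<^sup>+x. ennreal (exp (- (\<kappa> * x)) * norm (power_kernel a x)) \<partial>lborel)
    = ennreal (\<kappa> powr (- Re a)) * (\<integral>\<^sup>+x. ennreal (exp (- x) * norm (power_kernel a x)) \<partial>lborel)"
proof -
  have k: "norm (power_kernel a (x / \<kappa>)) = \<kappa> powr (1 - Re a) * norm (power_kernel a x)" for x
    using assms by (auto simp: norm_power_kernel powr_divide zero_less_divide_iff powr_diff field_simps)
  have "(\<integral>\<^sup>+x. ennreal (exp (- (\<kappa> * x)) * norm (power_kernel a x)) \<partial>lborel)
      = ennreal (1 / \<kappa>) * (\<integral>\<^sup>+x. ennreal (exp (- x) * norm (power_kernel a (x / \<kappa>))) \<partial>lborel)"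
    using assms
    by (subst nn_integral_real_affine[where t = 0 and c = "1 / \<kappa>"]) auto
  also have "\<dots> = ennreal (1 / \<kappa>) * (\<integral>\<^sup>+x. ennreal (\<kappa> powr (1 - Re a)) *
      ennreal (exp (- x) * norm (power_kernel a x)) \<partial>lborel)"
    by (simp add: k mult_ac flip: ennreal_mult')
  also have "\<dots> = (ennreal (1 / \<kappa>) * ennreal (\<kappa> powr (1 - Re a))) *
      (\<integral>\<^sup>+x. ennreal (exp (- x) * norm (power_kernel a x)) \<partial>lborel)"
    by (subst nn_integral_cmult) (auto simp: mult_ac)
  also have "ennreal (1 / \<kappa>) * ennreal (\<kappa> powr (1 - Re a)) = ennreal (\<kappa> powr (- Re a))"
    using assms by (simp add: powr_diff powr_minus field_simps flip: ennreal_mult')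
  finally show ?thesis .
qed

text \<open>This covers nonintegrable functions as well: their totalised integral is 0, so the bound
  is trivial.\<close>

lemma norm_integral_le_nn_integral:
  fixes f :: "'a \<Rightarrow> 'b::{banach, second_countable_topology}"
  shows "ennreal (norm (integral\<^sup>L M f)) \<le> (\<integral>\<^sup>+x. ennreal (norm (f x)) \<partial>M)"
  by (cases "integrable M f") (auto simp: integral_norm_bound_ennreal not_integrable_integral_eq)

text \<open>Let \<open>k\<close> be the weighted kernel and \<open>w\<close> the weighted modulus of
  M cut off at t. The equation bounds \<open>w\<close> by norm C times the convolution of
  \<open>k\<close> and \<open>w\<close>, so the mass \<open>\<Phi>\<close> of \<open>w\<close> is at
  most half of itself; being finite, it is 0.\<close>

lemma homogeneous_Volterra_eq_0:
  assumes \<nu>: "Re \<nu> > 0"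
    and M [measurable]: "M \<in> borel_measurable borel"
    and M0: "\<And>t. t \<le> 0 \<Longrightarrow> M t = 0"
    and int: "\<And>T. T > 0 \<Longrightarrow> integrable lborel (\<lambda>t. indicator {..T} t *\<^sub>R M t)"
    and eq: "\<And>t. t > 0 \<Longrightarrow> M t = C * (LINT \<tau>|lborel. power_kernel \<nu> (t - \<tau>) * M \<tau>)"
  shows "M t = 0"
proof (cases "t > 0")
  case T: True
  define L where "L = (LINT x|lborel. norm (power_kernel \<nu> x * of_real (exp (- x))))"
  have "L \<ge> 0" by (simp add: L_def)
  have L: "(\<integral>\<^sup>+x. ennreal (exp (- x) * norm (power_kernel \<nu> x)) \<partial>lborel) = ennreal L"
    using nn_integral_eq_integral[OF integrable_norm[OF Gamma_power_kernel(1)[OF \<nu>]]]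
    by (simp add: L_def norm_mult mult_ac)
  \<comment> \<open>\<open>A\<close> makes \<open>norm C * L / A\<close> at most 1/2, and the
    summand 1 keeps it positive. Then \<kappa> is chosen so that
    \<open>\<kappa> powr (- Re \<nu>)\<close> is 1 / A.\<close>
  define A where "A = 2 * norm C * L + 1"
  have "A > 0" using \<open>L \<ge> 0\<close> by (simp add: A_def add_nonneg_pos)
  define \<kappa> where "\<kappa> = A powr (1 / Re \<nu>)"
  have "\<kappa> > 0" using \<open>A > 0\<close> by (simp add: \<kappa>_def)
  have \<kappa>: "\<kappa> powr (- Re \<nu>) = 1 / A"
    using \<nu> \<open>A > 0\<close> by (simp add: \<kappa>_def powr_powr powr_minus_divide)
  define w where "w s = exp (- (\<kappa> * s)) * norm (M s) * indicator {..t} s" for s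
  have [measurable]: "w \<in> borel_measurable borel" unfolding w_def by measurable
  have w_nonneg: "w s \<ge> 0" for s by (simp add: w_def)
  define k where "k x = exp (- (\<kappa> * x)) * norm (power_kernel \<nu> x)" for x
  have [measurable]: "k \<in> borel_measurable borel" unfolding k_def by measurable
  have k_nonneg: "k x \<ge> 0" for x by (simp add: k_def)
  define \<Phi> where "\<Phi> = (\<integral>\<^sup>+s. ennreal (w s) \<partial>lborel)"
  have "\<Phi> \<le> (\<integral>\<^sup>+s. ennreal (norm (indicator {..t} s *\<^sub>R M s)) \<partial>lborel)"
    unfolding \<Phi>_def
  proof (intro nn_integral_mono ennreal_leI)
    fix s
    show "w s \<le> norm (indicator {..t} s *\<^sub>R M s)"
      using M0[of s] \<open>\<kappa> > 0\<close> by (cases "s \<le> 0") (auto simp: w_def indicator_def mult_left_le_one_le)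
  qed
  \<comment> \<open>Finiteness of \<open>\<Phi>\<close> is what allows the factor 1/2 to force it to
    0.\<close>
  also have "\<dots> < \<infinity>"
    using int[OF T] by (simp add: integrable_iff_bounded)
  finally have "\<Phi> < \<infinity>" .
  then obtain \<phi> where \<phi>: "\<phi> \<ge> 0" "\<Phi> = ennreal \<phi>"
    by (cases \<Phi> rule: ennreal_cases) auto
  have "ennreal (w s) \<le> (\<integral>\<^sup>+\<tau>. ennreal (norm C * (k (s - \<tau>) * w \<tau>)) \<partial>lborel)" for s
  proof (cases "0 < s \<and> s \<le> t")
    case True
    have "ennreal (norm (M s)) = ennreal (norm C) *
        ennreal (norm (LINT \<tau>|lborel. power_kernel \<nu> (s - \<tau>) * M \<tau>))"
      using True by (subst eq) (auto simp: norm_mult ennreal_mult')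
    also have "\<dots> \<le> ennreal (norm C) *
        (\<integral>\<^sup>+\<tau>. ennreal (norm (power_kernel \<nu> (s - \<tau>) * M \<tau>)) \<partial>lborel)"
      by (intro mult_left_mono norm_integral_le_nn_integral) auto
    finally have "ennreal (w s) \<le> ennreal (exp (- (\<kappa> * s))) * (ennreal (norm C) *
        (\<integral>\<^sup>+\<tau>. ennreal (norm (power_kernel \<nu> (s - \<tau>) * M \<tau>)) \<partial>lborel))"
      using True by (auto simp: w_def ennreal_mult' intro!: mult_left_mono)
    also have "\<dots> = (\<integral>\<^sup>+\<tau>. ennreal (exp (- (\<kappa> * s)) * (norm C *
        norm (power_kernel \<nu> (s - \<tau>) * M \<tau>))) \<partial>lborel)"
      by (subst nn_integral_cmult[symmetric], measurable)+ (simp add: ennreal_mult')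
    also have "(\<lambda>\<tau>. exp (- (\<kappa> * s)) * (norm C * norm (power_kernel \<nu> (s - \<tau>) * M \<tau>)))
        = (\<lambda>\<tau>. norm C * (k (s - \<tau>) * w \<tau>))"
    proof
      fix \<tau>
      \<comment> \<open>The exponential weight splits between the kernel and M. Where the kernel is
        nonzero, \<tau> < s <= t, so the cutoff in \<open>w\<close> is 1.\<close>
      have "exp (- (\<kappa> * s)) = exp (- (\<kappa> * (s - \<tau>))) * exp (- (\<kappa> * \<tau>))"
        by (simp add: algebra_simps flip: exp_add)
      then show "exp (- (\<kappa> * s)) * (norm C * norm (power_kernel \<nu> (s - \<tau>) * M \<tau>))
          = norm C * (k (s - \<tau>) * w \<tau>)"
        using True by (cases "\<tau> < s") (auto simp: k_def w_def norm_mult power_kernel_def)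
    qed
    finally show ?thesis .
  next
    case False
    then show ?thesis using M0[of s] by (cases "s \<le> t") (auto simp: w_def)
  qed
  then have "\<Phi> \<le> (\<integral>\<^sup>+s. \<integral>\<^sup>+\<tau>. ennreal (norm C * (k (s - \<tau>) * w \<tau>)) \<partial>lborel \<partial>lborel)"
    unfolding \<Phi>_def by (intro nn_integral_mono) auto
  \<comment> \<open>After Tonelli, translation invariance in s detaches the mass of the kernel from
    the integral over \<tau>.\<close>
  also have "\<dots> = (\<integral>\<^sup>+\<tau>. \<integral>\<^sup>+s. ennreal (norm C * (k (s - \<tau>) * w \<tau>)) \<partial>lborel \<partial>lborel)"
    by (rule lborel_pair.Fubini') measurable
  also have "\<dots> = (\<integral>\<^sup>+\<tau>. (ennreal (norm C) * (\<integral>\<^sup>+s. ennreal (k s) \<partial>lborel)) * ennreal (w \<tau>) \<partial>lborel)"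
  proof (intro nn_integral_cong)
    fix \<tau>
    have "(\<integral>\<^sup>+s. ennreal (norm C * (k (s - \<tau>) * w \<tau>)) \<partial>lborel)
        = (\<integral>\<^sup>+s. ennreal (norm C) * (ennreal (k (s - \<tau>)) * ennreal (w \<tau>)) \<partial>lborel)"
      using k_nonneg w_nonneg by (simp add: ennreal_mult')
    also have "\<dots> = ennreal (norm C) * ((\<integral>\<^sup>+s. ennreal (k (s - \<tau>)) \<partial>lborel) * ennreal (w \<tau>))"
      by (simp add: nn_integral_cmult nn_integral_multc)
    also have "(\<integral>\<^sup>+s. ennreal (k (s - \<tau>)) \<partial>lborel) = (\<integral>\<^sup>+s. ennreal (k s) \<partial>lborel)"
      using nn_integral_real_affine[of "\<lambda>s. ennreal (k s)" 1 "-\<tau>"] by simp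
    finally show "(\<integral>\<^sup>+s. ennreal (norm C * (k (s - \<tau>) * w \<tau>)) \<partial>lborel)
        = (ennreal (norm C) * (\<integral>\<^sup>+s. ennreal (k s) \<partial>lborel)) * ennreal (w \<tau>)"
      by (simp add: mult_ac)
  qed
  also have "\<dots> = (ennreal (norm C) * (\<integral>\<^sup>+s. ennreal (k s) \<partial>lborel)) * \<Phi>"
    unfolding \<Phi>_def by (rule nn_integral_cmult) measurable
  also have "\<dots> = ennreal (norm C * L / A * \<phi>)"
    using nn_integral_exp_power_kernel[OF \<open>\<kappa> > 0\<close>, of \<nu>] \<open>A > 0\<close> \<open>L \<ge> 0\<close> \<phi>(1)
    by (simp add: k_def L \<phi>(2) \<kappa> mult_ac flip: ennreal_mult')
  finally have "\<phi> \<le> norm C * L / A * \<phi>"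
    using \<phi> \<open>A > 0\<close> \<open>L \<ge> 0\<close> by (simp add: ennreal_le_iff)
  moreover have "norm C * L / A \<le> 1/2"
    using \<open>A > 0\<close> by (simp add: A_def field_simps)
  ultimately have "\<phi> \<le> 1/2 * \<phi>"
    using mult_right_mono[of "norm C * L / A" "1/2" \<phi>] \<phi>(1) by linarith
  then have "\<Phi> = 0" using \<phi> by simp
  then have "AE s in lborel. ennreal (w s) = 0"
    unfolding \<Phi>_def by (subst (asm) nn_integral_0_iff_AE) auto
  \<comment> \<open>Up to t, M vanishes almost everywhere since the weight is positive; beyond t the
    kernel vanishes. The equation at t then turns this into a pointwise statement.\<close>
  then have "AE \<tau> in lborel. power_kernel \<nu> (t - \<tau>) * M \<tau> = 0"
  proof eventually_elim
    case (elim \<tau>)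
    then have "w \<tau> = 0" using w_nonneg[of \<tau>] by (simp add: ennreal_eq_0_iff)
    then show ?case by (auto simp: w_def power_kernel_def indicator_def split: if_splits)
  qed
  then have "(LINT \<tau>|lborel. power_kernel \<nu> (t - \<tau>) * M \<tau>) = 0"
    by (rule integral_eq_zero_AE)
  then show ?thesis using eq[OF T] by simp
qed (simp add: M0)

section \<open>The series solution\<close>

text \<open>These are the terms of the Mittag-Leffler series for index \<nu> at the argument -(c
  t)^\<nu>.\<close>

definition kinetic_series :: "complex \<Rightarrow> real \<Rightarrow> real \<Rightarrow> nat \<Rightarrow> complex"
  where "kinetic_series \<nu> c t r = (- 1) ^ r * of_real (c * t) powr (\<nu> * of_nat r) / Gamma (\<nu> * of_nat r + 1)"

text \<open>The value 0 for t <= 0 prepares the function for convolution over the whole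
  line.\<close>

definition kinetic_function :: "complex \<Rightarrow> real \<Rightarrow> real \<Rightarrow> complex"
  where "kinetic_function \<nu> c t = (if t > 0 then suminf (kinetic_series \<nu> c t) else 0)"

lemma norm_kinetic_series:
  assumes "c > 0" "t > 0"
  shows "norm (kinetic_series \<nu> c t r) = ((c * t) powr Re \<nu>) ^ r * norm (rGamma (\<nu> * of_nat r + 1))"
proof -
  have "norm (of_real (c * t) powr (\<nu> * of_nat r)) = ((c * t) powr Re \<nu>) ^ r"
    using assms by (subst norm_powr_real_powr) (auto simp: powr_powr simp flip: powr_realpow)
  then show ?thesis
    by (simp add: kinetic_series_def norm_mult norm_divide norm_power rGamma_inverse_Gamma
        norm_inverse divide_inverse del: of_real_mult)
qed

lemma summable_norm_kinetic_series:
  assumes "Re \<nu> > 0" "c > 0" "t > 0"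
  shows "summable (\<lambda>r. norm (kinetic_series \<nu> c t r))"
  using assms by (simp add: norm_kinetic_series summable_Mittag_Leffler)

lemma norm_kinetic_series_mono:
  assumes "Re \<nu> > 0" "c > 0" "0 < s" "s \<le> t"
  shows "norm (kinetic_series \<nu> c s r) \<le> norm (kinetic_series \<nu> c t r)"
  using assms by (auto simp: norm_kinetic_series intro!: mult_right_mono power_mono powr_mono2)

text \<open>This isolates the dependence on t. The index of a kernel exceeds its exponent by one, so
  it coincides with the argument of Gamma in the coefficient.\<close>

lemma kinetic_series_eq_power_kernel:
  assumes "c > 0" "t > 0"
  shows "kinetic_series \<nu> c t r = kinetic_series \<nu> c 1 r * power_kernel (\<nu> * of_nat r + 1) t"
  using assms by (simp add: kinetic_series_def power_kernel_def powr_times_real)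

lemma kinetic_function_eq:
  assumes "c > 0"
  shows "kinetic_function \<nu> c t = (\<Sum>r. kinetic_series \<nu> c 1 r * power_kernel (\<nu> * of_nat r + 1) t)"
proof (cases "t > 0")
  case True
  then show ?thesis
    by (simp add: kinetic_function_def kinetic_series_eq_power_kernel[OF assms True, abs_def])
qed (simp add: kinetic_function_def power_kernel_def)

lemma borel_measurable_kinetic_function [measurable]:
  assumes "c > 0"
  shows "kinetic_function \<nu> c \<in> borel_measurable borel"
  unfolding kinetic_function_eq[OF assms, abs_def] by measurable

text \<open>On (0, T] each term is bounded in norm by its value at T, so the function is bounded by
  an absolutely convergent sum.\<close>

lemma integrable_kinetic_function:
  assumes "Re \<nu> > 0" "c > 0"
  shows "integrable lborel (\<lambda>t. indicator {..T} t *\<^sub>R kinetic_function \<nu> c t)"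
proof (rule Bochner_Integration.integrable_bound)
  define B where "B = (\<Sum>r. norm (kinetic_series \<nu> c T r))"
  show "integrable lborel (\<lambda>t. indicator {0..T} t * B)"
    by (cases "0 \<le> T") auto
  have "norm (kinetic_function \<nu> c t) \<le> \<bar>B\<bar>" if "0 < t" "t \<le> T" for t
  proof -
    have s: "summable (\<lambda>r. norm (kinetic_series \<nu> c t r))" "summable (\<lambda>r. norm (kinetic_series \<nu> c T r))"
      using summable_norm_kinetic_series[OF assms] that by auto
    have "norm (kinetic_function \<nu> c t) \<le> (\<Sum>r. norm (kinetic_series \<nu> c t r))"
      using that summable_norm[OF s(1)] by (simp add: kinetic_function_def)
    also have "\<dots> \<le> B"
      unfolding B_def by (intro suminf_le s norm_kinetic_series_mono assms that)
    finally show ?thesis by simp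
  qed
  then show "AE t in lborel. norm (indicator {..T} t *\<^sub>R kinetic_function \<nu> c t) \<le> norm (indicator {0..T} t * B)"
    by (intro AE_I2) (auto simp: indicator_def kinetic_function_def)
  have "kinetic_function \<nu> c \<in> borel_measurable borel" using assms by simp
  then show "(\<lambda>t. indicator {..T} t *\<^sub>R kinetic_function \<nu> c t) \<in> borel_measurable lborel"
    by measurable
qed

text \<open>Fractional integration sends term r to minus term r + 1. The result is therefore minus
  the series without its zeroth term, which is 1.\<close>

lemma convolution_kinetic_function:
  assumes \<nu>: "Re \<nu> > 0" and c: "c > 0" and t: "t > 0"
  shows "integrable lborel (\<lambda>\<tau>. power_kernel \<nu> (t - \<tau>) * kinetic_function \<nu> c \<tau>)" (is ?int)
    and "of_real c powr \<nu> / Gamma \<nu> * (LINT \<tau>|lborel. power_kernel \<nu> (t - \<tau>) * kinetic_function \<nu> c \<tau>)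
      = 1 - kinetic_function \<nu> c t" (is ?val)
proof -
  define f where "f r \<tau> = power_kernel \<nu> (t - \<tau>) *
    (kinetic_series \<nu> c 1 r * power_kernel (\<nu> * of_nat r + 1) \<tau>)" for r \<tau>
  have [measurable]: "f r \<in> borel_measurable borel" for r
    unfolding f_def by measurable
  let ?m = "\<lambda>r. norm (kinetic_series \<nu> c t r)"
  let ?K = "\<lambda>\<tau>. norm (indicator {0<..} \<tau> *\<^sub>R power_kernel \<nu> (t - \<tau>))"
  have m: "summable ?m" by (rule summable_norm_kinetic_series[OF \<nu> c t])
  have K: "integrable lborel ?K"
    by (intro integrable_norm integrable_power_kernel_reflect \<nu>)
  \<comment> \<open>The terms of the series on (0, t) are at most their values at t. A summable
    constant times one integrable function thus justifies exchanging sum and integral.\<close>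
  have bound: "norm (f r \<tau>) \<le> ?m r * ?K \<tau>" for r \<tau>
  proof (cases "0 < \<tau> \<and> \<tau> < t")
    case True
    then show ?thesis
      using norm_kinetic_series_mono[OF \<nu> c, of \<tau> t r]
      by (simp add: f_def norm_mult mult.commute mult_left_mono mult_right_mono flip: kinetic_series_eq_power_kernel[OF c])
  qed (auto simp: f_def power_kernel_def)
  have f_int: "integrable lborel (f r)" for r
    by (rule Bochner_Integration.integrable_bound[where f = "\<lambda>\<tau>. ?m r * ?K \<tau>"])
       (use K bound in \<open>auto simp: abs_mult\<close>)
  have f_sum: "summable (\<lambda>r. norm (f r \<tau>))" for \<tau>
    by (rule summable_comparison_test'[OF summable_mult2[OF m, of "?K \<tau>"], of 0]) (use bound in auto)
  have f_int_sum: "summable (\<lambda>r. LINT \<tau>|lborel. norm (f r \<tau>))"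
  proof (rule summable_comparison_test'[OF summable_mult2[OF m, of "integral\<^sup>L lborel ?K"], of 0])
    fix r
    have "(LINT \<tau>|lborel. norm (f r \<tau>)) \<le> (LINT \<tau>|lborel. ?m r * ?K \<tau>)"
      by (intro integral_mono integrable_norm f_int bound integrable_mult_right K)
    then show "norm (LINT \<tau>|lborel. norm (f r \<tau>)) \<le> ?m r * integral\<^sup>L lborel ?K"
      by simp
  qed
  have f_suminf: "(\<Sum>r. f r \<tau>) = power_kernel \<nu> (t - \<tau>) * kinetic_function \<nu> c \<tau>" for \<tau>
  proof (cases "0 < \<tau>")
    case True
    then have "summable (\<lambda>r. kinetic_series \<nu> c 1 r * power_kernel (\<nu> * of_nat r + 1) \<tau>)"
      using summable_norm_cancel[OF summable_norm_kinetic_series[OF \<nu> c True]]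
      by (simp add: kinetic_series_eq_power_kernel[OF c True, abs_def])
    then show ?thesis
      unfolding f_def kinetic_function_eq[OF c] by (rule suminf_mult)
  qed (simp add: f_def power_kernel_def kinetic_function_def)
  show ?int
    using integrable_suminf[OF f_int _ f_int_sum] f_sum by (simp add: f_suminf)
  have "(\<lambda>r. integral\<^sup>L lborel (f r)) sums
      (LINT \<tau>|lborel. power_kernel \<nu> (t - \<tau>) * kinetic_function \<nu> c \<tau>)"
    using sums_integral[OF f_int _ f_int_sum] f_sum by (simp add: f_suminf)
  then have "(\<lambda>r. of_real c powr \<nu> / Gamma \<nu> * integral\<^sup>L lborel (f r)) sums
      (of_real c powr \<nu> / Gamma \<nu> * (LINT \<tau>|lborel. power_kernel \<nu> (t - \<tau>) * kinetic_function \<nu> c \<tau>))"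
    by (rule sums_mult)
  \<comment> \<open>The Beta value cancels \<open>Gamma \<nu>\<close> and the Gamma value of index
    r, leaving the one of index r + 1.\<close>
  moreover have "of_real c powr \<nu> / Gamma \<nu> * integral\<^sup>L lborel (f r) = - kinetic_series \<nu> c t (Suc r)" for r
  proof -
    have \<nu>r: "Re (\<nu> * of_nat r + 1) > 0" by (rule Re_mult_of_nat_add_1_pos[OF \<nu>])
    have nz: "Gamma \<nu> \<noteq> 0" "Gamma (\<nu> * of_nat r + 1) \<noteq> 0"
      using notin_nonpos_Ints_if_Re_pos[OF \<nu>] notin_nonpos_Ints_if_Re_pos[OF \<nu>r]
      by (simp_all add: Gamma_eq_zero_iff)
    have "integral\<^sup>L lborel (f r) = kinetic_series \<nu> c 1 r *
        (LINT \<tau>|lborel. power_kernel \<nu> (t - \<tau>) * power_kernel (\<nu> * of_nat r + 1) \<tau>)"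
      unfolding f_def by (simp add: mult.left_commute flip: integral_mult_right_zero)
    also have "\<dots> = kinetic_series \<nu> c 1 r *
        (of_real t powr (\<nu> * of_nat (Suc r)) * Beta \<nu> (\<nu> * of_nat r + 1))"
      by (subst Beta_convolution[OF \<nu> \<nu>r t]) (simp add: algebra_simps)
    finally have "of_real c powr \<nu> / Gamma \<nu> * integral\<^sup>L lborel (f r)
        = (- 1) ^ r * (of_real c powr \<nu> * of_real c powr (\<nu> * of_nat r)) *
          of_real t powr (\<nu> * of_nat (Suc r)) / Gamma (\<nu> * of_nat (Suc r) + 1)"
      using nz by (simp add: kinetic_series_def Beta_def algebra_simps)
    also have "of_real c powr \<nu> * of_real c powr (\<nu> * of_nat r) = of_real c powr (\<nu> * of_nat (Suc r))"
      by (simp add: algebra_simps flip: powr_add)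
    finally show ?thesis
      using c t by (simp add: kinetic_series_def powr_times_real mult.assoc)
  qed
  ultimately have s: "(\<lambda>r. - kinetic_series \<nu> c t (Suc r)) sums
      (of_real c powr \<nu> / Gamma \<nu> * (LINT \<tau>|lborel. power_kernel \<nu> (t - \<tau>) * kinetic_function \<nu> c \<tau>))"
    by simp
  have "kinetic_series \<nu> c t sums kinetic_function \<nu> c t"
    using t summable_sums[OF summable_norm_cancel[OF m]] by (simp add: kinetic_function_def)
  \<comment> \<open>Positivity of c * t matters: by the convention \<open>0 powr 0 = 0\<close> the
    zeroth term would be 0 at t = 0.\<close>
  moreover have "kinetic_series \<nu> c t 0 = 1"
    using c t by (simp add: kinetic_series_def)
  ultimately have "(\<lambda>r. kinetic_series \<nu> c t (Suc r)) sums (kinetic_function \<nu> c t - 1)"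
    by (simp add: sums_Suc_iff)
  from sums_unique2[OF s sums_minus[OF this]] show ?val by simp
qed

section \<open>The scalar kinetic equation\<close>

lemma borel_measurable_lebesgue_restrict_pos:
  fixes g :: "real \<Rightarrow> complex"
  assumes "\<And>T. T > 0 \<Longrightarrow> g absolutely_integrable_on {0..T}"
  shows "(\<lambda>x. indicator {0<..} x *\<^sub>R g x) \<in> borel_measurable lebesgue"
proof (rule borel_measurable_LIMSEQ_metric)
  fix n :: nat
  \<comment> \<open>The cutoff is at n + 1 because integrability is given for T > 0. At each point
    the cutoffs are eventually constant.\<close>
  have "(\<lambda>x. indicator {0..real (Suc n)} x *\<^sub>R g x) \<in> borel_measurable lebesgue"
    using assms[of "real (Suc n)"] unfolding set_integrable_def
    by (intro borel_measurable_integrable) simp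
  then show "(\<lambda>x. indicator {0<..} x *\<^sub>R (indicator {0..real (Suc n)} x *\<^sub>R g x)) \<in> borel_measurable lebesgue"
    by (rule borel_measurable_scaleR[rotated]) (intro borel_measurable_indicator, simp)
next
  fix x :: real
  obtain m :: nat where m: "x \<le> real m" using real_arch_simple by blast
  show "(\<lambda>n. indicator {0<..} x *\<^sub>R (indicator {0..real (Suc n)} x *\<^sub>R g x)) \<longlonglongrightarrow> indicator {0<..} x *\<^sub>R g x"
    by (rule tendsto_eventually, rule eventually_sequentiallyI[of m])
       (use m in \<open>auto simp: indicator_def\<close>)
qed

lemma completion_ex_borel_measurable_complex:
  fixes g :: "'a \<Rightarrow> complex"
  assumes "g \<in> borel_measurable (completion M)"
  shows "\<exists>g'\<in>borel_measurable M. AE x in M. g x = g' x"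
proof -
  have "(\<lambda>x. Re (g x)) \<in> borel_measurable (completion M)" "(\<lambda>x. Im (g x)) \<in> borel_measurable (completion M)"
    using assms by measurable
  from this[THEN completion_ex_borel_measurable_real]
  obtain p q where pq [measurable]: "p \<in> borel_measurable M" "q \<in> borel_measurable M"
    and "AE x in M. Re (g x) = p x" "AE x in M. Im (g x) = q x"
    by blast
  then have "AE x in M. g x = complex_of_real (p x) + \<i> * complex_of_real (q x)"
    by (auto elim!: eventually_elim2 simp: complex_eq_iff)
  then show ?thesis
    by (intro bexI[where x = "\<lambda>x. complex_of_real (p x) + \<i> * complex_of_real (q x)"]) auto
qed

text \<open>The integrand on [0, t] and the kernel times the Borel representative \<open>G\<close>
  differ only on a null set, so integrability and integral carry over.\<close>

lemma RL_integral_eq_convolution: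
  assumes G [measurable]: "G \<in> borel_measurable borel"
    and g: "(\<lambda>\<tau>. indicator {0<..} \<tau> *\<^sub>R g \<tau>) \<in> borel_measurable lebesgue"
    and eq: "AE \<tau> in lborel. indicator {0<..} \<tau> *\<^sub>R g \<tau> = G \<tau>"
  shows "RL_integrand \<nu> g t absolutely_integrable_on {0..t} \<longleftrightarrow>
      integrable lborel (\<lambda>\<tau>. power_kernel \<nu> (t - \<tau>) * G \<tau>)" (is ?int)
    and "RL_integral \<nu> g t = 1 / Gamma \<nu> * (LINT \<tau>|lborel. power_kernel \<nu> (t - \<tau>) * G \<tau>)" (is ?val)
proof -
  define f where "f \<tau> = indicator {0..t} \<tau> *\<^sub>R RL_integrand \<nu> g t \<tau>" for \<tau>
  \<comment> \<open>At \<tau> = t both sides are 0, because a power of 0 is 0 by convention. Only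
    \<tau> = 0 is exceptional: there g is arbitrary, while the cutoff gives 0.\<close>
  have f_eq: "f \<tau> = power_kernel \<nu> (t - \<tau>) * (indicator {0<..} \<tau> *\<^sub>R g \<tau>)" if "\<tau> \<noteq> 0" for \<tau>
    using that by (auto simp: f_def RL_integrand_def power_kernel_def indicator_def)
  have k: "(\<lambda>\<tau>. power_kernel \<nu> (t - \<tau>)) \<in> borel_measurable lebesgue"
    by (intro measurable_completion) measurable
  have "(\<lambda>\<tau>. if \<tau> \<in> {0} then f 0 else power_kernel \<nu> (t - \<tau>) * (indicator {0<..} \<tau> *\<^sub>R g \<tau>))
      \<in> borel_measurable lebesgue"
    by (intro measurable_If_set borel_measurable_times k g) auto
  also have "(\<lambda>\<tau>. if \<tau> \<in> {0} then f 0 else power_kernel \<nu> (t - \<tau>) * (indicator {0<..} \<tau> *\<^sub>R g \<tau>)) = f"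
    using f_eq by auto
  finally have f: "f \<in> borel_measurable lebesgue" .
  have G': "(\<lambda>\<tau>. power_kernel \<nu> (t - \<tau>) * G \<tau>) \<in> borel_measurable lborel"
    by measurable
  then have G'': "(\<lambda>\<tau>. power_kernel \<nu> (t - \<tau>) * G \<tau>) \<in> borel_measurable lebesgue"
    by (rule measurable_completion)
  have ae: "AE \<tau> in lebesgue. f \<tau> = power_kernel \<nu> (t - \<tau>) * G \<tau>"
    using AE_completion[OF eq] AE_completion[OF AE_lborel_singleton[of 0]]
    by eventually_elim (simp add: f_eq)
  have "RL_integrand \<nu> g t absolutely_integrable_on {0..t} \<longleftrightarrow> integrable lebesgue f"
    by (simp only: set_integrable_def f_def[abs_def])
  also have "\<dots> \<longleftrightarrow> integrable lebesgue (\<lambda>\<tau>. power_kernel \<nu> (t - \<tau>) * G \<tau>)"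
    by (rule integrable_cong_AE[OF f G'' ae])
  finally show ?int
    by (simp add: integrable_completion[OF G'])
  have "RL_integral \<nu> g t = 1 / Gamma \<nu> * integral\<^sup>L lebesgue f"
    by (simp only: RL_integral_def set_lebesgue_integral_def f_def[abs_def])
  also have "integral\<^sup>L lebesgue f = (LINT \<tau>|lebesgue. power_kernel \<nu> (t - \<tau>) * G \<tau>)"
    by (rule integral_cong_AE[OF f G'' ae])
  finally show ?val
    by (simp only: integral_completion[OF G'])
qed

lemma absolutely_integrable_Icc_0_iff:
  fixes g :: "real \<Rightarrow> complex"
  shows "g absolutely_integrable_on {0..T} \<longleftrightarrow>
    integrable lebesgue (\<lambda>t. indicator {..T} t *\<^sub>R (indicator {0<..} t *\<^sub>R g t))"
  unfolding set_integrable_def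
  by (rule integrable_discrete_difference[where X = "{0}"]) (auto simp: indicator_def)

section \<open>Existence and uniqueness in one component\<close>

lemma kinetic_function_solves:
  assumes \<nu>: "Re \<nu> > 0" and c: "c > 0"
    and g: "\<And>t. t > 0 \<Longrightarrow> g t = n0 * kinetic_function \<nu> c t"
  shows "g absolutely_integrable_on {0..T}"
    and "t > 0 \<Longrightarrow> RL_integrand \<nu> g t absolutely_integrable_on {0..t}"
    and "t > 0 \<Longrightarrow> g t - n0 = - (of_real c powr \<nu> * RL_integral \<nu> g t)"
proof -
  \<comment> \<open>The cutoff discards the arbitrary values of g at x <= 0 and agrees there with
    the value 0 of \<open>kinetic_function\<close>.\<close>
  have gG: "indicator {0<..} x *\<^sub>R g x = n0 * kinetic_function \<nu> c x" for x
    by (simp add: g indicator_def kinetic_function_def)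
  have [measurable]: "kinetic_function \<nu> c \<in> borel_measurable borel"
    by (rule borel_measurable_kinetic_function[OF c])
  have G: "(\<lambda>x. n0 * kinetic_function \<nu> c x) \<in> borel_measurable borel"
    by measurable
  have gm: "(\<lambda>x. indicator {0<..} x *\<^sub>R g x) \<in> borel_measurable lebesgue"
    unfolding gG by (rule measurable_completion) measurable
  have "integrable lborel (\<lambda>x. n0 * (indicator {..T} x *\<^sub>R kinetic_function \<nu> c x))"
    by (intro integrable_mult_right integrable_kinetic_function[OF \<nu> c])
  then show "g absolutely_integrable_on {0..T}"
    unfolding absolutely_integrable_Icc_0_iff gG
    by (subst integrable_completion) auto
  note RL = RL_integral_eq_convolution[OF G gm AE_I2[OF gG]]
  have int: "integrable lborel (\<lambda>\<tau>. n0 * (power_kernel \<nu> (t - \<tau>) * kinetic_function \<nu> c \<tau>))" if "t > 0" for t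
    by (intro integrable_mult_right convolution_kinetic_function(1) that \<nu> c)
  then show "RL_integrand \<nu> g t absolutely_integrable_on {0..t}" if "t > 0"
    using RL(1)[of t \<nu>] that by (simp add: mult_ac)
  assume t: "t > 0"
  have "RL_integral \<nu> g t = 1 / Gamma \<nu> *
      (LINT \<tau>|lborel. n0 * (power_kernel \<nu> (t - \<tau>) * kinetic_function \<nu> c \<tau>))"
    unfolding RL(2) by (simp only: mult.left_commute)
  also have "\<dots> = 1 / Gamma \<nu> *
      (n0 * (LINT \<tau>|lborel. power_kernel \<nu> (t - \<tau>) * kinetic_function \<nu> c \<tau>))"
    by (simp only: integral_mult_right_zero)
  finally have "of_real c powr \<nu> * RL_integral \<nu> g t = n0 * (1 - kinetic_function \<nu> c t)"
    by (simp flip: convolution_kinetic_function(2)[OF \<nu> c t])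
  then show "g t - n0 = - (of_real c powr \<nu> * RL_integral \<nu> g t)"
    using t by (simp add: g algebra_simps)
qed

text \<open>In the difference \<open>M\<close> of g and the series solution the constant n0 cancels,
  so \<open>homogeneous_Volterra_eq_0\<close> applies with the constant \<open>- C\<close>.\<close>

lemma kinetic_solution_unique:
  assumes \<nu>: "Re \<nu> > 0" and c: "c > 0"
    and g: "\<And>T. T > 0 \<Longrightarrow> g absolutely_integrable_on {0..T}"
    and ex: "\<And>t. t > 0 \<Longrightarrow> RL_integrand \<nu> g t absolutely_integrable_on {0..t}"
    and eq: "\<And>t. t > 0 \<Longrightarrow> g t - n0 = - (of_real c powr \<nu> * RL_integral \<nu> g t)"
    and t: "t > 0"
  shows "g t = n0 * kinetic_function \<nu> c t"
proof -
  let ?E = "kinetic_function \<nu> c"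
  have E [measurable]: "?E \<in> borel_measurable borel"
    by (rule borel_measurable_kinetic_function[OF c])
  note gm = borel_measurable_lebesgue_restrict_pos[OF g]
  obtain H where H [measurable]: "H \<in> borel_measurable borel"
    and gH: "AE x in lborel. indicator {0<..} x *\<^sub>R g x = H x"
    using completion_ex_borel_measurable_complex[OF gm] by auto
  define G where "G x = indicator {0<..} x *\<^sub>R H x" for x
  have G [measurable]: "G \<in> borel_measurable borel" unfolding G_def by measurable
  have gG: "AE x in lborel. indicator {0<..} x *\<^sub>R g x = G x"
    using gH by eventually_elim (auto simp: G_def indicator_def)
  note RL = RL_integral_eq_convolution[OF G gm gG]
  define C where "C = of_real c powr \<nu> / Gamma \<nu>"
  define K where "K x = (LINT \<tau>|lborel. power_kernel \<nu> (x - \<tau>) * G \<tau>)" for x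
  have [measurable]: "K \<in> borel_measurable borel" unfolding K_def by measurable
  \<comment> \<open>\<open>G\<close> matches g only almost everywhere, but \<open>K\<close> sees it
    only under the integral. The equation thus expresses g at every positive point through the Borel
    function \<open>K\<close>, which makes \<open>M\<close> Borel.\<close>
  have gK: "g x = n0 - C * K x" if "x > 0" for x
  proof -
    have "g x - n0 = - (C * K x)"
      using eq[OF that] by (simp add: RL(2) C_def K_def)
    then show ?thesis by (simp add: algebra_simps)
  qed
  define M where "M x = (if x > 0 then g x - n0 * ?E x else 0)" for x
  have "M = (\<lambda>x. if x > 0 then n0 - C * K x - n0 * ?E x else 0)"
    by (auto simp: M_def gK)
  then have M [measurable]: "M \<in> borel_measurable borel" by simp
  have MG: "AE x in lborel. M x = G x - n0 * ?E x"
    using gG by eventually_elim (auto simp: M_def G_def kinetic_function_def)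
  have "M t = 0"
  proof (rule homogeneous_Volterra_eq_0[OF \<nu> M])
    fix T :: real assume "T > 0"
    have mG: "(\<lambda>x. indicator {..T} x *\<^sub>R G x) \<in> borel_measurable lborel" by measurable
    have "integrable lebesgue (\<lambda>x. indicator {..T} x *\<^sub>R (indicator {0<..} x *\<^sub>R g x))"
      using g[OF \<open>T > 0\<close>] by (simp only: absolutely_integrable_Icc_0_iff)
    also have "?this \<longleftrightarrow> integrable lebesgue (\<lambda>x. indicator {..T} x *\<^sub>R G x)"
    proof (rule integrable_cong_AE)
      show "(\<lambda>x. indicator {..T} x *\<^sub>R (indicator {0<..} x *\<^sub>R g x)) \<in> borel_measurable lebesgue"
        by (intro borel_measurable_scaleR borel_measurable_indicator gm) auto
      show "AE x in lebesgue. indicator {..T} x *\<^sub>R (indicator {0<..} x *\<^sub>R g x) = indicator {..T} x *\<^sub>R G x"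
        using AE_completion[OF gG] by eventually_elim simp
    qed (rule measurable_completion[OF mG])
    finally have "integrable lborel (\<lambda>x. indicator {..T} x *\<^sub>R G x)"
      by (simp only: integrable_completion[OF mG])
    then have "integrable lborel (\<lambda>x. indicator {..T} x *\<^sub>R G x - n0 * (indicator {..T} x *\<^sub>R ?E x))"
      by (intro Bochner_Integration.integrable_diff integrable_mult_right integrable_kinetic_function[OF \<nu> c])
    also have "?this \<longleftrightarrow> integrable lborel (\<lambda>x. indicator {..T} x *\<^sub>R M x)"
    proof (rule integrable_cong_AE)
      show "AE x in lborel. indicator {..T} x *\<^sub>R G x - n0 * (indicator {..T} x *\<^sub>R ?E x) = indicator {..T} x *\<^sub>R M x"
        using MG by eventually_elim (simp add: indicator_def)
    qed measurable
    finally show "integrable lborel (\<lambda>x. indicator {..T} x *\<^sub>R M x)" .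
  next
    fix s :: real assume s: "s > 0"
    have intG: "integrable lborel (\<lambda>\<tau>. power_kernel \<nu> (s - \<tau>) * G \<tau>)"
      using ex[OF s] by (simp add: RL(1))
    have intE: "integrable lborel (\<lambda>\<tau>. n0 * (power_kernel \<nu> (s - \<tau>) * ?E \<tau>))"
      by (intro integrable_mult_right convolution_kinetic_function(1) \<nu> c s)
    have "(LINT \<tau>|lborel. power_kernel \<nu> (s - \<tau>) * M \<tau>)
        = (LINT \<tau>|lborel. power_kernel \<nu> (s - \<tau>) * G \<tau> - n0 * (power_kernel \<nu> (s - \<tau>) * ?E \<tau>))"
    proof (rule integral_cong_AE)
      show "AE \<tau> in lborel. power_kernel \<nu> (s - \<tau>) * M \<tau> =
          power_kernel \<nu> (s - \<tau>) * G \<tau> - n0 * (power_kernel \<nu> (s - \<tau>) * ?E \<tau>)"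
        using MG by eventually_elim (simp only: right_diff_distrib mult.left_commute)
    qed measurable
    also have "\<dots> = K s - n0 * (LINT \<tau>|lborel. power_kernel \<nu> (s - \<tau>) * ?E \<tau>)"
      by (simp only: Bochner_Integration.integral_diff[OF intG intE] integral_mult_right_zero K_def)
    finally have diff: "(LINT \<tau>|lborel. power_kernel \<nu> (s - \<tau>) * M \<tau>)
        = K s - n0 * (LINT \<tau>|lborel. power_kernel \<nu> (s - \<tau>) * ?E \<tau>)" .
    \<comment> \<open>The series solution contributes n0 * (1 - ?E s), which supplies the n0 in the
      formula for g s.\<close>
    have "- C * (LINT \<tau>|lborel. power_kernel \<nu> (s - \<tau>) * M \<tau>)
        = - C * K s + n0 * (C * (LINT \<tau>|lborel. power_kernel \<nu> (s - \<tau>) * ?E \<tau>))"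
      unfolding diff by (simp add: algebra_simps)
    also have "C * (LINT \<tau>|lborel. power_kernel \<nu> (s - \<tau>) * ?E \<tau>) = 1 - ?E s"
      unfolding C_def by (rule convolution_kinetic_function(2)[OF \<nu> c s])
    finally show "M s = - C * (LINT \<tau>|lborel. power_kernel \<nu> (s - \<tau>) * M \<tau>)"
      using s by (simp add: M_def gK algebra_simps)
  qed (auto simp: M_def)
  then show ?thesis using t by (simp add: M_def)
qed

section \<open>Bicomplex series by components\<close>

text \<open>Up to a factor of modulus 1, \<open>bc_w1\<close> and \<open>bc_w2\<close> are half the
  sum and half the difference of the idempotent components. Convergence of these components
  therefore controls the Euclidean norm.\<close>

lemma norm_le_norm_bc_z: "norm Z \<le> norm (bc_z1 Z) + norm (bc_z2 Z)"
proof -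
  have w: "bc_w1 Z = (bc_z1 Z + bc_z2 Z) / 2" "bc_w2 Z = \<i> * (bc_z1 Z - bc_z2 Z) / 2"
    by (simp_all add: bc_z1_def bc_z2_def field_simps)
  have "norm (bc_w1 Z) \<le> (norm (bc_z1 Z) + norm (bc_z2 Z)) / 2"
      "norm (bc_w2 Z) \<le> (norm (bc_z1 Z) + norm (bc_z2 Z)) / 2"
    using norm_triangle_ineq[of "bc_z1 Z" "bc_z2 Z"] norm_triangle_ineq4[of "bc_z1 Z" "bc_z2 Z"]
    by (simp_all only: w norm_divide norm_mult) simp_all
  moreover have "norm Z \<le> norm (bc_w1 Z) + norm (bc_w2 Z)"
    unfolding norm_bicomplex_def by (rule sqrt_sum_squares_le_sum) auto
  ultimately show ?thesis
    by (metis add_mono field_sum_of_halves order_trans)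
qed

lemma bc_z_sum: "bc_z1 (sum f A) = (\<Sum>x\<in>A. bc_z1 (f x))" "bc_z2 (sum f A) = (\<Sum>x\<in>A. bc_z2 (f x))"
  by (induction A rule: infinite_finite_induct) auto

lemma bc_z_power: "bc_z1 (Z ^ n) = bc_z1 Z ^ n" "bc_z2 (Z ^ n) = bc_z2 Z ^ n"
  by (induction n) auto

lemma bc_z_of_nat: "bc_z1 (of_nat n) = of_nat n" "bc_z2 (of_nat n) = of_nat n"
  by (induction n) auto

lemma sums_bicomplex:
  assumes "(\<lambda>r. bc_z1 (f r)) sums bc_z1 S" "(\<lambda>r. bc_z2 (f r)) sums bc_z2 S"
  shows "f sums S"
proof -
  have "(\<lambda>n. norm (bc_z1 (sum f {..<n} - S)) + norm (bc_z2 (sum f {..<n} - S))) \<longlonglongrightarrow> 0"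
    using assms by (auto simp: sums_def bc_z_sum intro!: tendsto_add_zero tendsto_norm_zero LIM_zero)
  then have "(\<lambda>n. norm (sum f {..<n} - S)) \<longlonglongrightarrow> 0"
    by (rule Lim_null_comparison[rotated]) (simp add: norm_le_norm_bc_z del: bc_z_ring)
  then show ?thesis
    by (simp add: sums_def LIM_zero_iff tendsto_norm_zero_iff)
qed

section \<open>The bicomplex equation from its two components\<close>

theorem theorem6p1:
  fixes \<alpha> \<beta> :: complex and V N0 :: bicomplex and c :: real
  assumes "V = Bicomplex \<alpha> \<beta>"
    and "c > 0"
    and "Re \<alpha> > \<bar>Im \<beta>\<bar>"
  shows "(\<forall>t>0. summable (\<lambda>r. (- 1) ^ r * ((c * t) bc_powr (V * of_nat r))
                              / bc_Gamma (V * of_nat r + 1))) \<and>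
         (\<forall>N. solves_fractional_kinetic V c N0 N \<longleftrightarrow>
              (\<forall>t>0. N t = N0 * (\<Sum>r. (- 1) ^ r * ((c * t) bc_powr (V * of_nat r))
                                       / bc_Gamma (V * of_nat r + 1))))"
proof -
  \<comment> \<open>The components of V have real parts Re \<alpha> + Im \<beta> and Re \<alpha> -
    Im \<beta>; the hypothesis makes both positive.\<close>
  have \<nu>1: "Re (bc_z1 V) > 0" and \<nu>2: "Re (bc_z2 V) > 0"
    using assms(3) by (auto simp: assms(1) bc_z1_def bc_z2_def)
  note c = \<open>c > 0\<close>
  have sums: "(\<lambda>r. (- 1) ^ r * ((c * t) bc_powr (V * of_nat r)) / bc_Gamma (V * of_nat r + 1)) sums
      bc_idem (kinetic_function (bc_z1 V) c t) (kinetic_function (bc_z2 V) c t)"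
    if t: "t > 0" for t
  proof (rule sums_bicomplex)
    have "kinetic_series \<nu> c t sums kinetic_function \<nu> c t" if "Re \<nu> > 0" for \<nu>
      using t summable_sums[OF summable_norm_cancel[OF summable_norm_kinetic_series[OF that c t]]]
      by (simp add: kinetic_function_def)
    from this[OF \<nu>1] this[OF \<nu>2]
    show "(\<lambda>r. bc_z1 ((- 1) ^ r * ((c * t) bc_powr (V * of_nat r)) / bc_Gamma (V * of_nat r + 1))) sums
        bc_z1 (bc_idem (kinetic_function (bc_z1 V) c t) (kinetic_function (bc_z2 V) c t))"
      and "(\<lambda>r. bc_z2 ((- 1) ^ r * ((c * t) bc_powr (V * of_nat r)) / bc_Gamma (V * of_nat r + 1))) sums
        bc_z2 (bc_idem (kinetic_function (bc_z1 V) c t) (kinetic_function (bc_z2 V) c t))"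
      by (simp_all add: divide_bicomplex_def bc_powr_def bc_Gamma_def bc_z_power bc_z_of_nat
          kinetic_series_def[abs_def])
  qed
  \<comment> \<open>The equation, the existence of the fractional integral and local integrability
    all split componentwise, so each direction applies a scalar result twice.\<close>
  have solves_iff: "solves_fractional_kinetic V c N0 N \<longleftrightarrow>
      (\<forall>t>0. bc_z1 (N t) = bc_z1 N0 * kinetic_function (bc_z1 V) c t \<and>
             bc_z2 (N t) = bc_z2 N0 * kinetic_function (bc_z2 V) c t)" (is "?L \<longleftrightarrow> ?R") for N
  proof
    assume ?L
    then have *:
      "\<And>T. T > 0 \<Longrightarrow> (\<lambda>\<tau>. bc_z1 (N \<tau>)) absolutely_integrable_on {0..T}"
      "\<And>T. T > 0 \<Longrightarrow> (\<lambda>\<tau>. bc_z2 (N \<tau>)) absolutely_integrable_on {0..T}"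
      "\<And>t. t > 0 \<Longrightarrow> RL_integrand (bc_z1 V) (\<lambda>\<tau>. bc_z1 (N \<tau>)) t absolutely_integrable_on {0..t}"
      "\<And>t. t > 0 \<Longrightarrow> RL_integrand (bc_z2 V) (\<lambda>\<tau>. bc_z2 (N \<tau>)) t absolutely_integrable_on {0..t}"
      "\<And>t. t > 0 \<Longrightarrow> bc_z1 (N t) - bc_z1 N0
        = - (of_real c powr bc_z1 V * RL_integral (bc_z1 V) (\<lambda>\<tau>. bc_z1 (N \<tau>)) t)"
      "\<And>t. t > 0 \<Longrightarrow> bc_z2 (N t) - bc_z2 N0
        = - (of_real c powr bc_z2 V * RL_integral (bc_z2 V) (\<lambda>\<tau>. bc_z2 (N \<tau>)) t)"
      by (simp_all add: solves_fractional_kinetic_def bc_locally_integrable_def bc_RL_exists_def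
          bc_RL_integral_def bc_powr_def bicomplex_eq_iff_z)
    show ?R
      using kinetic_solution_unique[OF \<nu>1 c *(1,3,5)] kinetic_solution_unique[OF \<nu>2 c *(2,4,6)]
      by blast
  next
    assume R: ?R
    note k1 = kinetic_function_solves[OF \<nu>1 c, of "\<lambda>t. bc_z1 (N t)" "bc_z1 N0"]
    note k2 = kinetic_function_solves[OF \<nu>2 c, of "\<lambda>t. bc_z2 (N t)" "bc_z2 N0"]
    show ?L
      using R k1 k2
      by (simp add: solves_fractional_kinetic_def bc_locally_integrable_def bc_RL_exists_def
          bc_RL_integral_def bc_powr_def bicomplex_eq_iff_z)
  qed
  have "N t = N0 * (\<Sum>r. (- 1) ^ r * ((c * t) bc_powr (V * of_nat r)) / bc_Gamma (V * of_nat r + 1))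
      \<longleftrightarrow> bc_z1 (N t) = bc_z1 N0 * kinetic_function (bc_z1 V) c t \<and>
          bc_z2 (N t) = bc_z2 N0 * kinetic_function (bc_z2 V) c t" if "t > 0" for N t
    by (simp add: sums_unique[OF sums[OF that], symmetric] bicomplex_eq_iff_z)
  with sums solves_iff show ?thesis
    by (auto simp: sums_iff)
qed

end
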